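(* Let $R$ be a principal ideal domain that is not a field and let $I$ be a nonzero proper ideal of $R$. If $I$ is a weakly $1$-absorbing prime ideal of $R$, then $I=pR$ or $I=p^2R$ for some nonzero prime element $p$ of $R$.
   Context: All rings are commutative with identity. A proper ideal $I$ of a ring $R$ (i.e. $I\neq R$) is called weakly $1$-absorbing prime if for all nonunit elements $a,b,c\in R$ with $0\neq abc\in I$, either $ab\in I$ or $c\in I$. *)

theory Defs
  imports "HOL-Algebra.Ring_Divisibility"
begin

locale weakly_1_absorbing_prime = ideal I R + cring R for I and R (structure) +
  assumes I_notcarr: "carrier R \<noteq> I"
    and weakly_1_absorbing:
      "\<lbrakk>a \<in> carrier R - Units R; b \<in> carrier R - Units R; c \<in> carrier R - Units R;
        a \<otimes> b \<otimes> c \<noteq> \<zero>; a \<otimes> b \<otimes> c \<in> I\<rbrakk> \<Longrightarrow> a \<otimes> b \<in> I \<or> c \<in> I"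

end

theory Submission
  imports Defs
begin

text \<open>
  Write \<open>I = xR\<close> and \<open>x = py\<close> with \<open>p\<close> irreducible. If \<open>y\<close> is a unit, then \<open>I = pR\<close>.
  Otherwise apply the hypothesis to the triple \<open>p, p, y\<close>, whose product \<open>px\<close> is a nonzero
  element of \<open>I\<close>. Since \<open>y \<in> I\<close> would make \<open>p\<close> a unit, \<open>p\<^sup>2\<close> is a multiple of \<open>py\<close>;
  so \<open>y\<close> divides \<open>p\<close>, hence is associated to it, and \<open>I = p\<^sup>2R\<close>.
\<close>

theorem corollary2p16:
  fixes R (structure) and I
  assumes "principal_domain R"
    and "\<not> field R"
    and "ideal I R"
    and "I \<noteq> {\<zero>}"
    and "I \<noteq> carrier R"
    and "weakly_1_absorbing_prime I R"
  shows "\<exists>p \<in> carrier R. ring_prime p \<and> (I = PIdl p \<or> I = PIdl (p [^] (2::nat)))"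
proof -
  interpret principal_domain R by fact
  obtain x where x: "x \<in> carrier R" and I: "I = PIdl x"
    using exists_gen[OF assms(3)] by blast
  have mem_I: "z \<in> I \<longleftrightarrow> (\<exists>r\<in>carrier R. z = r \<otimes> x)" for z
    unfolding I cgenideal_def by blast
  \<comment> \<open>As \<open>I\<close> is nonzero and proper, its generator is a nonzero nonunit,
    which is what an irreducible divisor requires.\<close>
  have "x \<noteq> \<zero>"
    using assms(4) mem_I by fastforce
  moreover have "x \<notin> Units R"
    using assms(5) I ideal_eq_carrier_iff[OF x] by simp
  ultimately obtain p where p: "p \<in> carrier R" "ring_irreducible p" and "p divides x"
    using exists_irreducible_divisor x by blast
  then obtain y where y: "y \<in> carrier R" and x_eq: "x = p \<otimes> y"
    unfolding factor_def by blast
  have nz: "p \<noteq> \<zero>" "y \<noteq> \<zero>"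
    using \<open>x \<noteq> \<zero>\<close> x_eq p(1) y by auto
  have p_nonunit: "p \<notin> Units R"
    using ring_irreducibleE(4)[OF p] .
  have "I = PIdl p \<or> I = PIdl (p [^] (2::nat))"
  proof (cases "y \<in> Units R")
    case True
    then have "x \<sim> p"
      using ring_associated_iff[OF x p(1)] x_eq m_comm[OF p(1) y] by blast
    then show ?thesis
      using I associated_iff_same_ideal[OF x p(1)] by simp
  next
    case False
    have "y \<notin> I"
    proof
      assume "y \<in> I"
      then obtain r where r: "r \<in> carrier R" "y = r \<otimes> (p \<otimes> y)"
        using mem_I x_eq by blast
      then have "(r \<otimes> p) \<otimes> y = \<one> \<otimes> y"
        using p(1) y by (simp add: m_assoc)
      then have "\<one> = p \<otimes> r"
        using m_rcancel[of y "r \<otimes> p" \<one>] nz r(1) p(1) y by (simp add: m_comm)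
      then show False
        using p_nonunit divides_one[OF p(1)] r(1) unfolding factor_def by blast
    qed
    moreover have "p \<otimes> p \<otimes> y \<in> I"
      using mem_I x_eq m_assoc[OF p(1) p(1) y] p(1) by blast
    moreover have "p \<otimes> p \<otimes> y \<noteq> \<zero>"
      using nz p(1) y by (simp add: integral_iff)
    ultimately have "p \<otimes> p \<in> I"
      using weakly_1_absorbing_prime.weakly_1_absorbing[OF assms(6), of p p y]
        p(1) y p_nonunit False by blast
    then obtain r where r: "r \<in> carrier R" "p \<otimes> p = r \<otimes> (p \<otimes> y)"
      using mem_I x_eq by blast
    then have "p \<otimes> p = p \<otimes> (r \<otimes> y)"
      using p(1) y by (simp add: m_lcomm)
    then have "p = r \<otimes> y"
      using m_lcancel[of p p "r \<otimes> y"] nz r(1) p(1) y by simp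
    \<comment> \<open>Irreducibility of \<open>p\<close> with \<open>y\<close> a nonunit leaves
      \<open>r\<close> as the unit factor; the same \<open>r\<close> relates
      \<open>p \<otimes> p\<close> to \<open>x\<close>.\<close>
    then have "r \<in> Units R"
      using ring_irreducibleE(5)[OF p r(1) y] False by blast
    then have "p \<otimes> p \<sim> x"
      using ring_associated_iff[of "p \<otimes> p" x] p(1) x r(2) x_eq by blast
    then have "PIdl (p \<otimes> p) = I"
      using I associated_iff_same_ideal[of "p \<otimes> p" x] p(1) x by simp
    then show ?thesis
      using p(1) by (simp add: numeral_2_eq_2)
  qed
  \<comment> \<open>In a principal ideal domain irreducible elements are prime.\<close>
  then show ?thesis
    using p primeness_condition by blast
qed

end
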